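(* Let $k\geq 3$ and let $G$ be a $k$-regular graph. Then the vertex set of the graph $\mathcal{J}_k$ constructed from $G$ can be partitioned into $k+1$ independent dominating sets of $\mathcal{J}_k$.
   Context: Given a $k$-regular graph $G$, the graph $\mathcal{J}_k$ is defined as follows. Its vertex set is $\{v_e : v\in V(G),\ e\in E(G) \text{ incident with } v\}\cup\{e_{v,u,i} : e=vu\in E(G),\ i\in[k-1]\}$ (for each edge $e=vu$ there are $k-1$ vertices $e_{v,u,1},\dots,e_{v,u,k-1}$). Its edge set is $\{v_ev_{e'} : v\in V(G),\ e\neq e' \text{ both incident with } v\}\cup\{e_{v,u,i}e_{v,u,i'} : i\neq i'\}\cup\{v_e e_{v,u,i} : i\in[k-1],\ e=vu \text{ incident with } v\}$; thus for each edge $e=vu$, the vertices $e_{v,u,1},\dots,e_{v,u,k-1}$ form a clique and each is adjacent to both $v_e$ and $u_e$, and for each vertex $v$ the vertices $v_e$ ($e\ni v$) form a clique. A set $S$ of vertices of a graph $H$ is an independent dominating set if no two vertices of $S$ are adjacent and every vertex of $H$ not in $S$ has a neighbor in $S$. Here $[m]=\{1,\dots,m\}$. *)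

theory Defs
  imports "HOL-Library.Ramsey" "HOL-Library.Disjoint_Sets"
begin

(* A graph is given by its vertex set V and its edge set E; edges are 2-element sets
   of vertices, which is also the representation used by Ramsey.indep. *)

definition finite_simple_graph :: "'a set \<Rightarrow> 'a set set \<Rightarrow> bool" where
  "finite_simple_graph V E \<longleftrightarrow> finite V \<and> E \<subseteq> [V]\<^bsup>2\<^esup>"

definition regular_graph :: "nat \<Rightarrow> 'a set \<Rightarrow> 'a set set \<Rightarrow> bool" where
  "regular_graph k V E \<longleftrightarrow> (\<forall>v\<in>V. card {e \<in> E. v \<in> e} = k)"

definition independent_dominating :: "'a set \<Rightarrow> 'a set set \<Rightarrow> 'a set \<Rightarrow> bool" where
  "independent_dominating V E S \<longleftrightarrow>
     S \<subseteq> V \<and> indep S E \<and> (\<forall>x \<in> V - S. \<exists>y \<in> S. {x, y} \<in> E)"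

(* Vertices of J_k: "Corner v e" is v_e and "Inner e i" is e_{v,u,i} for e = vu.
   The edge e is an unordered pair, and there is a single family of k - 1 vertices
   per edge, i.e. e_{v,u,i} and e_{u,v,i} denote the same vertex. *)

datatype 'a J_vertex = Corner 'a "'a set" | Inner "'a set" nat

definition J_verts :: "nat \<Rightarrow> 'a set \<Rightarrow> 'a set set \<Rightarrow> 'a J_vertex set" where
  "J_verts k V E =
     {Corner v e | v e. v \<in> V \<and> e \<in> E \<and> v \<in> e} \<union>
     {Inner e i | e i. e \<in> E \<and> i \<in> {1..k - 1}}"

definition J_edges :: "nat \<Rightarrow> 'a set \<Rightarrow> 'a set set \<Rightarrow> 'a J_vertex set set" where
  "J_edges k V E =
     {{Corner v e, Corner v e'} | v e e'.
        v \<in> V \<and> e \<in> E \<and> e' \<in> E \<and> v \<in> e \<and> v \<in> e' \<and> e \<noteq> e'} \<union>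
     {{Inner e i, Inner e i'} | e i i'.
        e \<in> E \<and> i \<in> {1..k - 1} \<and> i' \<in> {1..k - 1} \<and> i \<noteq> i'} \<union>
     {{Corner v e, Inner e i} | v e i.
        v \<in> V \<and> e \<in> E \<and> v \<in> e \<and> i \<in> {1..k - 1}}"

lemma J_edges_subset: "J_edges k V E \<subseteq> [J_verts k V E]\<^bsup>2\<^esup>"
  unfolding J_edges_def J_verts_def by (auto simp del: atLeastAtMost_iff)

lemma finite_simple_graph_J:
  assumes "finite_simple_graph V E"
  shows "finite_simple_graph (J_verts k V E) (J_edges k V E)"
proof -
  have "finite V" and "finite E"
    using assms finite_imp_finite_nsets finite_subset
    unfolding finite_simple_graph_def by blast+
  then have "finite ((\<lambda>(v, e). Corner v e) ` (V \<times> E) \<union> (\<lambda>(e, i). Inner e i) ` (E \<times> {1..k - 1}))"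
    by blast
  then have "finite (J_verts k V E)"
    by (rule rev_finite_subset) (auto simp: J_verts_def)
  then show ?thesis
    using J_edges_subset unfolding finite_simple_graph_def by blast
qed

end

theory Submission
  imports Defs
begin

text \<open>
  An inner vertex has degree k, so in a partition into k + 1 independent dominating sets it and
  its neighbours carry all the colours. Hence it suffices to colour the corners with k colours so
  that the corners at each vertex of G receive all k of them and the two corners of each edge
  receive different ones; the inner vertices of an edge then take the k - 1 remaining colours.
  Such a colouring of the corners is obtained from an arbitrary one that is bijective at each vertex.
  For two colours a and b, the corners coloured a or b form a union of two matchings (the pairs at
  the same vertex, the pairs on the same edge). This graph is bipartite, so these corners can be
  recoloured with a and b without conflict, and no other colour is affected.
\<close>

section \<open>Two-colouring a union of two matchings\<close>

text \<open>The maps \<open>s\<close> and \<open>t\<close> are perfect matchings, and their union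
  splits into even cycles and two-way infinite paths. Alternate vertices along such a component form
  one orbit of the composition \<open>t\<close> after \<open>s\<close>, so each component consists
  of two orbits, exchanged by both maps. Colouring one orbit of each component gives
  \<open>g\<close>.\<close>

lemma two_colouring_involutions:
  fixes s t :: "'b \<Rightarrow> 'b"
  assumes ss: "\<And>x. s (s x) = x" and tt: "\<And>x. t (t x) = x"
    and s_neq: "\<And>x. s x \<noteq> x" and t_neq: "\<And>x. t x \<noteq> x"
  obtains g :: "'b \<Rightarrow> bool" where "\<And>x. g (s x) \<longleftrightarrow> \<not> g x" "\<And>x. g (t x) \<longleftrightarrow> \<not> g x"
proof -
  define p where "p x = t (s x)" for x
  \<comment> \<open>Lying in one orbit of \<open>p\<close>. Allowing a forward power on either side
    replaces negative powers.\<close>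
  define R where "R x y \<longleftrightarrow> (\<exists>n. y = (p ^^ n) x \<or> x = (p ^^ n) y)" for x y
  have inj_p: "inj p" unfolding p_def by (metis injI ss tt)
  \<comment> \<open>This is the absence of odd cycles. Conjugation by \<open>s\<close> inverts
    \<open>p\<close>, so a power \<open>n + 2\<close> taking \<open>x\<close> to \<open>s x\<close>
    yields a power \<open>n\<close> taking \<open>p x\<close> to \<open>s (p x)\<close>. The descent
    ends at a fixed point of \<open>s\<close> or of \<open>t\<close>.\<close>
  have power_neq: "(p ^^ n) x \<noteq> s x" for n x
  proof (induction n arbitrary: x rule: induct_nat_012)
    case 0 show ?case using s_neq by (metis funpow_0)
  next
    case 1 show ?case using t_neq by (simp add: p_def)
  next
    case (ge2 n)
    show ?case
    proof
      assume "(p ^^ Suc (Suc n)) x = s x"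
      then have "p ((p ^^ n) (p x)) = s x" by (simp add: funpow_swap1)
      then have "(p ^^ n) (p x) = s (p x)" by (metis p_def ss tt)
      then show False using ge2 by blast
    qed
  qed
  have sym: "R x y \<Longrightarrow> R y x" for x y unfolding R_def by blast
  have refl: "R x x" for x unfolding R_def by (metis funpow_0)
  have comparable: "R ((p ^^ m) z) ((p ^^ n) z)" for m n z
  proof (cases "m \<le> n")
    case True
    then have "(p ^^ n) z = (p ^^ (n - m)) ((p ^^ m) z)"
      by (metis comp_apply funpow_add le_add_diff_inverse2)
    then show ?thesis unfolding R_def by blast
  next
    case False
    then have "(p ^^ m) z = (p ^^ (m - n)) ((p ^^ n) z)"
      by (metis comp_apply funpow_add le_add_diff_inverse2 nat_le_linear)
    then show ?thesis unfolding R_def by blast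
  qed
  have R_step: "R x y \<Longrightarrow> R (p x) y" for x y
  proof -
    assume "R x y"
    then consider n where "y = (p ^^ n) x" | n where "x = (p ^^ n) y" unfolding R_def by blast
    then show "R (p x) y"
    proof cases
      case 1 then show ?thesis using comparable[of 1 x n] by simp
    next
      case 2 then show ?thesis using comparable[of "Suc n" y 0] by simp
    qed
  qed
  have R_unstep: "R (p x) y \<Longrightarrow> R x y" for x y
  proof -
    assume "R (p x) y"
    then consider n where "y = (p ^^ n) (p x)" | n where "p x = (p ^^ n) y" unfolding R_def by blast
    then show "R x y"
    proof cases
      case 1 then show ?thesis unfolding R_def by (metis funpow_Suc_right comp_apply)
    next
      case 2
      show ?thesis
      proof (cases n)
        case 0
        then show ?thesis using 2 unfolding R_def by (metis funpow_0 funpow_Suc_right comp_apply)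
      next
        case (Suc m)
        then have "x = (p ^^ m) y" using 2 inj_p by (simp add: inj_eq)
        then show ?thesis unfolding R_def by blast
      qed
    qed
  qed
  have R_p: "R (p x) y \<longleftrightarrow> R x y" for x y using R_step R_unstep by blast
  have R_pow: "R ((p ^^ n) x) y \<longleftrightarrow> R x y" for n x y by (induction n) (auto simp: R_p)
  have trans: "R x y \<Longrightarrow> R y z \<Longrightarrow> R x z" for x y z
    using R_pow unfolding R_def[of x y] by blast
  have R_s: "\<not> R x (s x)" for x
    unfolding R_def using power_neq by (metis ss)
  \<comment> \<open>The component of \<open>x\<close>: its own orbit and that of
    \<open>s x\<close>.\<close>
  define D where "D x = {y. R x y \<or> R (s x) y}" for x
  \<comment> \<open>The choice depends only on the set \<open>D x\<close>, so all points of a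
    component share one representative. The colour of \<open>x\<close> then records whether
    \<open>x\<close> lies in the orbit of that representative.\<close>
  define r where "r x = (SOME y. y \<in> D x)" for x
  have D_s: "D (s x) = D x" for x unfolding D_def using ss by auto
  have t_eq: "t x = p (s x)" for x by (simp add: p_def ss)
  have st: "p (s (t x)) = x" for x by (simp add: p_def ss tt)
  have R_t: "R (t x) y \<longleftrightarrow> R (s x) y" for x y by (simp add: t_eq R_p)
  have R_st: "R (s (t x)) y \<longleftrightarrow> R x y" for x y using R_p[of "s (t x)" y] st by simp
  have D_t: "D (t x) = D x" for x unfolding D_def by (auto simp: R_t R_st)
  have "r x \<in> D x" for x
    unfolding r_def by (rule someI[of _ x]) (simp add: D_def refl)
  then have one: "R x (r x) \<or> R (s x) (r x)" for x unfolding D_def by blast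
  have not_both: "\<not> (R x y \<and> R (s x) y)" for x y using R_s sym trans by blast
  have r_s: "r (s x) = r x" and r_t: "r (t x) = r x" for x by (simp_all add: r_def D_s D_t)
  show thesis
  proof (rule that[of "\<lambda>x. R x (r x)"])
    show "R (s x) (r (s x)) \<longleftrightarrow> \<not> R x (r x)" for x
      unfolding r_s using one not_both by blast
    show "R (t x) (r (t x)) \<longleftrightarrow> \<not> R x (r x)" for x
      unfolding r_t R_t using one not_both by blast
  qed
qed

text \<open>
  Two copies of the graph, with the copies of each unmatched point joined, turn partial matchings
  into perfect ones.
\<close>

lemma two_colouring_matchings:
  fixes s t :: "'b \<Rightarrow> 'b"
  assumes s: "\<And>x. x \<in> X \<Longrightarrow> s x \<in> X \<and> s (s x) = x \<and> s x \<noteq> x"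
    and t: "\<And>x. x \<in> X \<Longrightarrow> t x \<in> X \<Longrightarrow> t (t x) = x \<and> t x \<noteq> x"
  obtains g :: "'b \<Rightarrow> bool" where
    "\<And>x. x \<in> X \<Longrightarrow> g (s x) \<longleftrightarrow> \<not> g x"
    "\<And>x. x \<in> X \<Longrightarrow> t x \<in> X \<Longrightarrow> g (t x) \<longleftrightarrow> \<not> g x"
proof -
  define s' where "s' z = (if fst z \<in> X then (s (fst z), snd z) else (fst z, \<not> snd z))" for z
  define t' where
    "t' z = (if fst z \<in> X \<and> t (fst z) \<in> X then (t (fst z), snd z) else (fst z, \<not> snd z))" for z
  have "s' (s' z) = z" "t' (t' z) = z" "s' z \<noteq> z" "t' z \<noteq> z" for z
    using s[of "fst z"] t[of "fst z"] by (cases z; auto simp: s'_def t'_def)+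
  then obtain g where g: "\<And>z. g (s' z) \<longleftrightarrow> \<not> g z" "\<And>z. g (t' z) \<longleftrightarrow> \<not> g z"
    by (rule two_colouring_involutions[of s' t']) (rule that)
  show thesis
  proof (rule that[of "\<lambda>x. g (x, True)"])
    show "g (s x, True) \<longleftrightarrow> \<not> g (x, True)" if "x \<in> X" for x
      using g(1)[of "(x, True)"] that by (simp add: s'_def)
    show "g (t x, True) \<longleftrightarrow> \<not> g (x, True)" if "x \<in> X" "t x \<in> X" for x
      using g(2)[of "(x, True)"] that by (simp add: t'_def)
  qed
qed

section \<open>Colouring the corners\<close>

text \<open>A Kempe-style exchange on the corners coloured \<open>a\<close> or \<open>b\<close>.
  Alternation along \<open>s\<close> keeps both colours present once at each vertex, and alternation
  along \<open>t\<close> separates the two corners of an edge when both are in this class. If only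
  one is, the other corner keeps a third colour and no conflict arises.\<close>

lemma recolour_two_colours:
  fixes c :: "'a \<Rightarrow> 'a set \<Rightarrow> nat"
  assumes E: "E \<subseteq> [V]\<^bsup>2\<^esup>"
    and bij: "\<And>v. v \<in> V \<Longrightarrow> bij_betw (c v) {e \<in> E. v \<in> e} K"
    and fin: "finite K" and ab: "a \<in> K" "b \<in> K" "a \<noteq> b"
  obtains c' where
    "\<And>v. v \<in> V \<Longrightarrow> bij_betw (c' v) {e \<in> E. v \<in> e} K"
    "\<And>v e. v \<in> V \<Longrightarrow> e \<in> E \<Longrightarrow> v \<in> e \<Longrightarrow> c' v e \<notin> {a, b} \<Longrightarrow> c' v e = c v e"
    "\<And>u v e. e \<in> E \<Longrightarrow> e = {u, v} \<Longrightarrow> c' u e \<in> {a, b} \<Longrightarrow> c' u e \<noteq> c' v e"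
proof -
  define I where "I v = {e \<in> E. v \<in> e}" for v
  define X where "X = {(v, e). v \<in> V \<and> e \<in> I v \<and> c v e \<in> {a, b}}"
  \<comment> \<open>The edge at \<open>v\<close> that carries the other one of the colours
    \<open>a\<close> and \<open>b\<close>.\<close>
  define p where "p v e = inv_into (I v) (c v) (if c v e = a then b else a)" for v e
  define s where "s = (\<lambda>(v, e). (v, p v e))"
  \<comment> \<open>The opposite corner of the same edge. It may lie outside \<open>X\<close>, which
    is why only a partial matching is available here.\<close>
  define t where "t = (\<lambda>(v, e). (THE u. u \<in> e \<and> u \<noteq> v, e :: 'a set))"
  have bijI: "bij_betw (c v) (I v) K" if "v \<in> V" for v using bij that by (simp add: I_def)
  have p_in: "p v e \<in> I v" and cp: "c v (p v e) = (if c v e = a then b else a)" if "v \<in> V" for v e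
    using bijI[OF that] ab unfolding p_def bij_betw_def
    by (auto intro: inv_into_into f_inv_into_f)
  have inj: "e = e'" if "v \<in> V" "e \<in> I v" "e' \<in> I v" "c v e = c v e'" for v e e'
    using bijI[OF that(1)] that unfolding bij_betw_def inj_on_def by blast
  have s_X: "s x \<in> X \<and> s (s x) = x \<and> s x \<noteq> x" if "x \<in> X" for x
  proof -
    obtain v e where x: "x = (v, e)" "v \<in> V" "e \<in> I v" "c v e \<in> {a, b}"
      using \<open>x \<in> X\<close> unfolding X_def by auto
    have "p v (p v e) = e"
      by (rule inj[OF x(2)]) (use x ab p_in cp in auto)
    moreover have "p v e \<noteq> e" using cp[OF x(2), of e] ab by (auto split: if_splits)
    ultimately show ?thesis using x p_in[OF x(2)] cp[OF x(2)] by (auto simp: s_def X_def)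
  qed
  have t_eq: "t (u, {u, v}) = (v, {u, v})" if "u \<noteq> v" for u v
    using that unfolding t_def by auto
  have edge: "\<exists>u. e = {u, v} \<and> u \<noteq> v \<and> u \<in> V" if "e \<in> E" "v \<in> e" for e v
    using E that unfolding nsets_def by (fastforce simp: card_2_iff subset_iff)
  have t_X: "t (t x) = x \<and> t x \<noteq> x" if x: "x \<in> X" for x
  proof -
    obtain v e where x: "x = (v, e)" "e \<in> E" "v \<in> e"
      using \<open>x \<in> X\<close> unfolding X_def I_def by auto
    then obtain u where u: "e = {u, v}" "u \<noteq> v" using edge by blast
    then show ?thesis using x t_eq[of u v] t_eq[of v u] by (auto simp: insert_commute)
  qed
  obtain g where g_s: "\<And>x. x \<in> X \<Longrightarrow> g (s x) \<longleftrightarrow> \<not> g x"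
    and g_t: "\<And>x. x \<in> X \<Longrightarrow> t x \<in> X \<Longrightarrow> g (t x) \<longleftrightarrow> \<not> g x"
    using two_colouring_matchings[of X s t] s_X t_X by blast
  define c' where "c' v e = (if (v, e) \<in> X then (if g (v, e) then a else b) else c v e)" for v e
  have in_X: "(v, e) \<in> X \<longleftrightarrow> c' v e \<in> {a, b}" if "v \<in> V" "e \<in> I v" for v e
    using that unfolding c'_def by (auto simp: X_def)
  have inj': "inj_on (c' v) (I v)" if v: "v \<in> V" for v
  proof (rule inj_onI, rule ccontr)
    fix e e' assume e: "e \<in> I v" "e' \<in> I v" and eq: "c' v e = c' v e'" and "e \<noteq> e'"
    show False
    proof (cases "(v, e) \<in> X")
      case True
      then have X': "(v, e') \<in> X" using in_X v e eq by metis
      \<comment> \<open>Two distinct edges at \<open>v\<close> that carry colours from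
        \<open>a\<close> and \<open>b\<close> carry one each, so they are partners under
        \<open>s\<close>.\<close>
      have "c v e \<noteq> c v e'" using inj v e \<open>e \<noteq> e'\<close> by blast
      then have "p v e = e'" using inj[OF v p_in[OF v] e(2)] cp[OF v] True X'
        by (auto simp: X_def)
      then have "g (v, e') \<longleftrightarrow> \<not> g (v, e)" using g_s[OF True] by (simp add: s_def)
      then show False using eq True X' ab(3) by (auto simp: c'_def split: if_splits)
    next
      case False
      then have "(v, e') \<notin> X" using in_X v e eq by metis
      then have "c v e = c v e'" using eq False by (simp add: c'_def)
      then show False using inj v e \<open>e \<noteq> e'\<close> by blast
    qed
  qed
  show thesis
  proof (rule that[of c'])
    fix v assume v: "v \<in> V"
    have "c' v ` I v \<subseteq> K"
      using bijI[OF v] ab by (auto simp: c'_def bij_betw_def)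
    moreover have "card (c' v ` I v) = card K"
      using card_image[OF inj'[OF v]] bij_betw_same_card[OF bijI[OF v]] by simp
    ultimately show "bij_betw (c' v) {e \<in> E. v \<in> e} K"
      using inj'[OF v] fin card_subset_eq unfolding bij_betw_def I_def by blast
  next
    show "c' v e = c v e" if "v \<in> V" "e \<in> E" "v \<in> e" "c' v e \<notin> {a, b}" for v e
      using that by (auto simp: c'_def split: if_splits)
  next
    fix u v e assume e: "e \<in> E" "e = {u, v}" and c: "c' u e \<in> {a, b}"
    have uv: "u \<noteq> v" "u \<in> V" "v \<in> V" using edge[of e u] edge[of e v] e by auto
    have I: "e \<in> I u" "e \<in> I v" using e by (auto simp: I_def)
    have uX: "(u, e) \<in> X" using in_X c uv I by blast
    show "c' u e \<noteq> c' v e"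
    proof
      assume eq: "c' u e = c' v e"
      then have vX: "(v, e) \<in> X" using in_X c uv I by metis
      have "g (v, e) \<longleftrightarrow> \<not> g (u, e)"
        using g_t[OF uX] vX t_eq[OF uv(1)] e by simp
      then show False using eq uX vX ab(3) by (auto simp: c'_def split: if_splits)
    qed
  qed
qed

text \<open>Induction on the number \<open>m\<close> of colours already free of conflicts on edges.
  For \<open>m = 0\<close> any choice of bijections at the vertices will do; for
  \<open>m = k\<close> no conflict is left.\<close>

lemma exists_corner_colouring:
  assumes k: "k \<ge> 2" and E: "E \<subseteq> [V]\<^bsup>2\<^esup>" and reg: "regular_graph k V E"
  obtains c :: "'a \<Rightarrow> 'a set \<Rightarrow> nat" where
    "\<And>v. v \<in> V \<Longrightarrow> bij_betw (c v) {e \<in> E. v \<in> e} {1..k}"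
    "\<And>u v e. e \<in> E \<Longrightarrow> e = {u, v} \<Longrightarrow> c u e \<noteq> c v e"
proof -
  have "\<exists>c :: 'a \<Rightarrow> 'a set \<Rightarrow> nat. (\<forall>v\<in>V. bij_betw (c v) {e \<in> E. v \<in> e} {1..k}) \<and>
     (\<forall>e\<in>E. \<forall>u v. e = {u, v} \<longrightarrow> c u e \<in> {1..m} \<longrightarrow> c u e \<noteq> c v e)" if "m \<le> k" for m
    using that
  proof (induction m)
    case 0
    have "\<exists>f :: 'a set \<Rightarrow> nat. bij_betw f {e \<in> E. v \<in> e} {1..k}" if "v \<in> V" for v
    proof (rule finite_same_card_bij)
      show card: "card {e \<in> E. v \<in> e} = card {1..k}"
        using reg that unfolding regular_graph_def by simp
      show "finite {e \<in> E. v \<in> e}" by (rule card_ge_0_finite) (use card k in simp)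
    qed simp
    then show ?case by (simp, metis)
  next
    case (Suc m)
    from Suc.IH[OF Suc_leD[OF Suc.prems]] obtain c :: "'a \<Rightarrow> 'a set \<Rightarrow> nat"
      where c: "\<forall>v\<in>V. bij_betw (c v) {e \<in> E. v \<in> e} {1..k}"
        "\<forall>e\<in>E. \<forall>u v. e = {u, v} \<longrightarrow> c u e \<in> {1..m} \<longrightarrow> c u e \<noteq> c v e"
      by (elim exE conjE) (rule that)
    note bij = c(1)[rule_format] and proper = c(2)[rule_format]
    \<comment> \<open>The colour exchanged with \<open>Suc m\<close>. For positive \<open>m\<close>
      it is the settled colour 1, which the recolouring leaves free of conflicts; for
      \<open>m = 0\<close> it is 2, available because \<open>k\<close> is at least 2.\<close>
    define b where "b = (if m = 0 then 2 else 1 :: nat)"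
    have b: "b \<in> {1..k}" "Suc m \<noteq> b" using k by (auto simp: b_def)
    obtain c' where c': "\<And>v. v \<in> V \<Longrightarrow> bij_betw (c' v) {e \<in> E. v \<in> e} {1..k}"
      "\<And>v e. v \<in> V \<Longrightarrow> e \<in> E \<Longrightarrow> v \<in> e \<Longrightarrow> c' v e \<notin> {Suc m, b} \<Longrightarrow> c' v e = c v e"
      "\<And>u v e. e \<in> E \<Longrightarrow> e = {u, v} \<Longrightarrow> c' u e \<in> {Suc m, b} \<Longrightarrow> c' u e \<noteq> c' v e"
      by (rule recolour_two_colours[OF E bij _ _ b]) (use Suc.prems in auto)
    have "c' u e \<noteq> c' v e" if e: "e \<in> E" "e = {u, v}" "c' u e \<in> {1..Suc m}" for e u v
    proof (cases "c' u e \<in> {Suc m, b}")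
      case True then show ?thesis using c'(3) e by blast
    next
      case False
      have "u \<in> V" "v \<in> V" using E e by (auto simp: nsets_def)
      then have "c' u e = c u e" "c' v e \<notin> {Suc m, b} \<Longrightarrow> c' v e = c v e"
        using c'(2) False e by auto
      \<comment> \<open>The corner at \<open>u\<close> kept a settled colour. The corner at
        \<open>v\<close> either kept its colour too, so the old properness applies, or now has
        colour \<open>Suc m\<close> or \<open>b\<close>, which the corner at \<open>u\<close> does
        not have.\<close>
      moreover have "c u e \<in> {1..m}" using False e(3) \<open>c' u e = c u e\<close> by auto
      ultimately show ?thesis using proper[OF e(1,2)] False by metis
    qed
    then show ?case using c'(1) by blast
  qed
  from this[OF order_refl] obtain c :: "'a \<Rightarrow> 'a set \<Rightarrow> nat"
    where c: "\<forall>v\<in>V. bij_betw (c v) {e \<in> E. v \<in> e} {1..k}"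
      "\<forall>e\<in>E. \<forall>u v. e = {u, v} \<longrightarrow> c u e \<in> {1..k} \<longrightarrow> c u e \<noteq> c v e"
    by (elim exE conjE) (rule that)
  note bij = c(1)[rule_format] and proper = c(2)[rule_format]
  have "c u e \<noteq> c v e" if e: "e \<in> E" "e = {u, v}" for u v e
  proof (rule proper[OF e])
    have "u \<in> V" using E e by (auto simp: nsets_def)
    then show "c u e \<in> {1..k}" using bij_betwE[OF bij] e by blast
  qed
  then show thesis using that bij by blast
qed

section \<open>Colour classes as independent dominating sets\<close>

text \<open>Such a \<open>col\<close> is a fall colouring: properness makes each colour class
  independent, and each vertex seeing all other colours makes each class dominating.\<close>

lemma partition_independent_dominating_of_colouring:
  assumes surj: "col ` V = K"
    and proper: "\<And>x y. {x, y} \<in> F \<Longrightarrow> x \<noteq> y \<Longrightarrow> col x \<noteq> col y"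
    and F: "F \<subseteq> [V]\<^bsup>2\<^esup>"
    and dom: "\<And>x j. x \<in> V \<Longrightarrow> j \<in> K \<Longrightarrow> j \<noteq> col x \<Longrightarrow> \<exists>y\<in>V. col y = j \<and> {x, y} \<in> F"
  shows "\<exists>P. partition_on V P \<and> card P = card K \<and> (\<forall>S\<in>P. independent_dominating V F S)"
proof (intro exI conjI)
  define C where "C j = {x \<in> V. col x = j}" for j
  have ne: "C j \<noteq> {}" if "j \<in> K" for j using surj that unfolding C_def by blast
  have "inj_on C K"
  proof (rule inj_onI)
    fix i j assume "i \<in> K" "j \<in> K" "C i = C j"
    then show "i = j" using ne[of i] unfolding C_def by blast
  qed
  then show "card (C ` K) = card K" by (rule card_image)
  show "partition_on V (C ` K)"
    unfolding partition_on_def disjoint_def using surj ne by (auto simp: C_def)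
  show "\<forall>S\<in>C ` K. independent_dominating V F S"
  proof
    fix S assume "S \<in> C ` K"
    then obtain j where j: "j \<in> K" "S = C j" by blast
    have "e \<notin> F" if e: "e \<in> [S]\<^bsup>2\<^esup>" for e
    proof
      assume "e \<in> F"
      from e obtain x y where "e = {x, y}" "x \<noteq> y" "x \<in> S" "y \<in> S"
        unfolding nsets_def by (auto simp: card_2_iff)
      then show False using proper[of x y] \<open>e \<in> F\<close> j by (auto simp: C_def)
    qed
    moreover have "\<exists>y\<in>S. {x, y} \<in> F" if "x \<in> V - S" for x
      using dom[of x j] j that by (auto simp: C_def)
    ultimately show "independent_dominating V F S"
      unfolding independent_dominating_def indep_def using j by (auto simp: C_def)
  qed
qed

theorem theorem2:
  fixes V :: "'a set" and E :: "'a set set" and k :: nat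
  assumes "k \<ge> 3"
    and "finite_simple_graph V E"
    and "V \<noteq> {}"
    and "regular_graph k V E"
  shows "\<exists>P. partition_on (J_verts k V E) P \<and> card P = k + 1 \<and>
           (\<forall>S\<in>P. independent_dominating (J_verts k V E) (J_edges k V E) S)"
proof -
  have E: "E \<subseteq> [V]\<^bsup>2\<^esup>" using assms(2) by (simp add: finite_simple_graph_def)
  obtain c :: "'a \<Rightarrow> 'a set \<Rightarrow> nat"
    where bij: "\<And>v. v \<in> V \<Longrightarrow> bij_betw (c v) {e \<in> E. v \<in> e} {1..k}"
      and proper: "\<And>u v e. e \<in> E \<Longrightarrow> e = {u, v} \<Longrightarrow> c u e \<noteq> c v e"
    by (rule exists_corner_colouring[OF _ E assms(4)]) (use assms(1) in auto)
  define used where "used e = (\<lambda>v. c v e) ` e" for e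
  have edge: "\<exists>u v. e = {u, v} \<and> u \<in> V \<and> v \<in> V" if "e \<in> E" for e
    using E that unfolding nsets_def by (fastforce simp: card_2_iff subset_iff)
  have c_range: "c v e \<in> {1..k}" if "v \<in> V" "e \<in> E" "v \<in> e" for v e
    using bij[OF that(1)] that by (auto dest: bij_betwE)
  \<comment> \<open>The two corners of \<open>e\<close> use two distinct colours, leaving exactly
    \<open>k - 1\<close> of the \<open>k + 1\<close> for the inner vertices. Colour
    \<open>k + 1\<close> occurs only there.\<close>
  have "\<exists>f. bij_betw f {1..k - 1} ({1..k + 1} - used e)" if e: "e \<in> E" for e
  proof -
    obtain u v where uv: "e = {u, v}" "u \<in> V" "v \<in> V" using edge e by blast
    have "c u e \<noteq> c v e" using proper e uv by blast
    then have "card (used e) = 2" unfolding used_def using uv by auto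
    moreover have "used e \<subseteq> {1..k + 1}"
      unfolding used_def using c_range[OF _ e] uv by fastforce
    ultimately have "card ({1..k + 1} - used e) = k - 1"
      by (simp add: card_Diff_subset finite_subset)
    then show ?thesis by (intro finite_same_card_bij) auto
  qed
  then obtain h where h: "\<And>e. e \<in> E \<Longrightarrow> bij_betw (h e) {1..k - 1} ({1..k + 1} - used e)"
    by metis
  have h_image: "h e ` {1..k - 1} = {1..k + 1} - used e" if "e \<in> E" for e
    using h that by (simp add: bij_betw_def)
  define col where "col x = (case x of Corner v e \<Rightarrow> c v e | Inner e i \<Rightarrow> h e i)" for x
  have col [simp]: "col (Corner v e) = c v e" "col (Inner e i) = h e i" for v e i
    by (simp_all add: col_def)
  have vertexE: "(\<exists>v e. x = Corner v e \<and> v \<in> V \<and> e \<in> E \<and> v \<in> e) \<or>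
      (\<exists>e i. x = Inner e i \<and> e \<in> E \<and> i \<in> {1..k - 1})" if "x \<in> J_verts k V E" for x
    using that unfolding J_verts_def by blast
  have vertexI: "v \<in> V \<Longrightarrow> e \<in> E \<Longrightarrow> v \<in> e \<Longrightarrow> Corner v e \<in> J_verts k V E"
    "e \<in> E \<Longrightarrow> i \<in> {1..k - 1} \<Longrightarrow> Inner e i \<in> J_verts k V E" for v e i
    unfolding J_verts_def by blast+
  have edgeI1: "{Corner v e, Corner v e'} \<in> J_edges k V E"
    if "v \<in> V" "e \<in> E" "e' \<in> E" "v \<in> e" "v \<in> e'" "e \<noteq> e'" for v e e'
    unfolding J_edges_def by (rule UnI1, rule UnI1) (use that in blast)
  have edgeI2: "{Inner e i, Inner e i'} \<in> J_edges k V E"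
    if "e \<in> E" "i \<in> {1..k - 1}" "i' \<in> {1..k - 1}" "i \<noteq> i'" for e i i'
    unfolding J_edges_def by (rule UnI1, rule UnI2) (use that in blast)
  have edgeI3: "{Corner v e, Inner e i} \<in> J_edges k V E"
    if "v \<in> V" "e \<in> E" "v \<in> e" "i \<in> {1..k - 1}" for v e i
    unfolding J_edges_def by (rule UnI2) (use that in blast)
  have edgeI4: "{Inner e i, Corner v e} \<in> J_edges k V E"
    if "v \<in> V" "e \<in> E" "v \<in> e" "i \<in> {1..k - 1}" for v e i
    using edgeI3[OF that] by (simp add: insert_commute)
  have on_edge: "j \<in> used e \<or> (\<exists>i\<in>{1..k - 1}. h e i = j)" if "e \<in> E" "j \<in> {1..k + 1}" for e j
    using h_image[OF that(1)] that(2) by (metis DiffI imageE)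
  have dom: "\<exists>y\<in>J_verts k V E. col y = j \<and> {x, y} \<in> J_edges k V E"
    if x: "x \<in> J_verts k V E" and j: "j \<in> {1..k + 1}" "j \<noteq> col x" for x j
    using vertexE[OF x]
  proof (elim disjE exE conjE)
    fix v e assume x: "x = Corner v e" and v: "v \<in> V" "e \<in> E" "v \<in> e"
    show ?thesis
    proof (cases "j \<in> used e")
      case False
      then obtain i where "i \<in> {1..k - 1}" "h e i = j" using on_edge v j by blast
      then show ?thesis using x v vertexI(2) edgeI3 col(2) by metis
    next
      case True
      \<comment> \<open>Here \<open>j\<close> is the colour of the other corner of \<open>e\<close>,
        so no inner vertex of \<open>e\<close> has it. Being a corner colour, it also occurs at
        \<open>v\<close>, on another edge.\<close>
      then have "j \<in> {1..k}" using c_range v(2) edge[OF v(2)] unfolding used_def by auto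
      then obtain e' where e': "e' \<in> E" "v \<in> e'" "c v e' = j"
        using bij[OF v(1)] unfolding bij_betw_def by (smt (verit) imageE mem_Collect_eq)
      then have "e \<noteq> e'" using j x by auto
      then show ?thesis using x v e' vertexI(1) edgeI1 col(1) by metis
    qed
  next
    fix e i assume x: "x = Inner e i" and e: "e \<in> E" "i \<in> {1..k - 1}"
    from on_edge[OF e(1) j(1)] show ?thesis
    proof
      assume "j \<in> used e"
      then obtain v where v: "v \<in> e" "c v e = j" unfolding used_def by blast
      moreover have "v \<in> V" using v edge[OF e(1)] by blast
      ultimately show ?thesis using x e vertexI(1) edgeI4 col(1) by metis
    next
      assume "\<exists>i\<in>{1..k - 1}. h e i = j"
      then obtain i' where "i' \<in> {1..k - 1}" "h e i' = j" by blast
      moreover have "i \<noteq> i'" using calculation j x by auto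
      ultimately show ?thesis using x e vertexI(2) edgeI2 col(2) by metis
    qed
  qed
  have corners: "c v e \<noteq> c v e'" if "v \<in> V" "e \<in> E" "e' \<in> E" "v \<in> e" "v \<in> e'" "e \<noteq> e'" for v e e'
    using bij[OF that(1)] that unfolding bij_betw_def inj_on_def by blast
  have inners: "h e i \<noteq> h e i'"
    if "e \<in> E" "i \<in> {1..k - 1}" "i' \<in> {1..k - 1}" "i \<noteq> i'" for e i i'
    using h[OF that(1)] that unfolding bij_betw_def inj_on_def by blast
  have mixed: "c v e \<noteq> h e i" if "e \<in> E" "v \<in> e" "i \<in> {1..k - 1}" for v e i
    using h_image[OF that(1)] that unfolding used_def by blast
  have proper_J: "col x \<noteq> col y" if "{x, y} \<in> J_edges k V E" "x \<noteq> y" for x y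
    using that(1) unfolding J_edges_def
    by (elim UnE) (auto simp: doubleton_eq_iff simp del: atLeastAtMost_iff
      dest: corners corners[symmetric] inners mixed mixed[symmetric])
  have range: "col x \<in> {1..k + 1}" if "x \<in> J_verts k V E" for x
    using vertexE[OF that]
  proof (elim disjE exE conjE)
    fix v e assume "x = Corner v e" "v \<in> V" "e \<in> E" "v \<in> e"
    then show ?thesis using c_range[of v e] by simp
  next
    fix e i assume "x = Inner e i" "e \<in> E" "i \<in> {1..k - 1}"
    then show ?thesis using h_image[of e] by (metis DiffD1 col(2) imageI)
  qed
  \<comment> \<open>A single vertex of the new graph suffices for surjectivity: by
    \<open>dom\<close> its neighbours show every colour but its own.\<close>
  obtain v where v: "v \<in> V" using assms(3) by blast
  have "1 \<in> {1..k}" using assms(1) by simp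
  then obtain e where "e \<in> E" "v \<in> e"
    using bij[OF v] unfolding bij_betw_def by (smt (verit) imageE mem_Collect_eq)
  then have "Corner v e \<in> J_verts k V E" using vertexI v by blast
  then have "col ` J_verts k V E = {1..k + 1}"
    using range dom by (metis imageI image_subsetI subsetI subset_antisym)
  from partition_independent_dominating_of_colouring[OF this proper_J J_edges_subset dom]
  show ?thesis by simp
qed

end
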